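(* The category $\operatorname{\mathsf{Mod}}\mathbb Z$ of modules over $\mathbb Z$ does not admit an almost split sequence $0\to X\to Y\to Z\to 0$ with $Z=\mathbb Q$.
   Context: In an additive category, a morphism $\beta\colon Y\to Z$ is right almost split if $\beta$ is not a retraction (split epimorphism) and every morphism $Y'\to Z$ that is not a retraction factors through $\beta$. Dually, $\alpha\colon X\to Y$ is left almost split if $\alpha$ is not a section (split monomorphism) and every morphism $X\to Y'$ that is not a section factors through $\alpha$. In an abelian category, an exact sequence $0\to X\xrightarrow{\alpha}Y\xrightarrow{\beta}Z\to0$ is almost split if $\alpha$ is left almost split and $\beta$ is right almost split. *)

theory Defs
  imports "HOL.Rat" "HOL-Algebra.IntRing" "HOL-Algebra.Module"
begin

text \<open>
  The category \<open>Mod R\<close> is formed inside a universe given by a type \<open>'u\<close>: its objects are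
  the \<open>R\<close>-modules whose carrier is a set of elements of \<open>'u\<close>. All quantifications over
  objects of the category, in particular the one over \<open>Y'\<close> in the definition of almost split
  morphisms, range over this universe. A sequence that is almost split with respect to all modules whatsoever
  is in particular almost split in every universe that contains its terms. Morphisms are functions on the whole type that matter only
  on the carrier of their domain, so that equality of morphisms is equality on that carrier.
\<close>

definition mod_hom ::
    "('r, 'm) ring_scheme \<Rightarrow> ('r, 'a) module \<Rightarrow> ('r, 'b) module \<Rightarrow> ('a \<Rightarrow> 'b) set"
  where "mod_hom R M N =
    {h \<in> hom (add_monoid M) (add_monoid N).
       \<forall>r\<in>carrier R. \<forall>x\<in>carrier M. h (r \<odot>\<^bsub>M\<^esub> x) = r \<odot>\<^bsub>N\<^esub> h x}"

definition mod_iso ::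
    "('r, 'm) ring_scheme \<Rightarrow> ('r, 'a) module \<Rightarrow> ('r, 'b) module \<Rightarrow> bool"
  where "mod_iso R M N \<longleftrightarrow> (\<exists>h\<in>mod_hom R M N. bij_betw h (carrier M) (carrier N))"

definition retraction ::
    "('r, 'm) ring_scheme \<Rightarrow> ('r, 'a) module \<Rightarrow> ('r, 'b) module \<Rightarrow> ('a \<Rightarrow> 'b) \<Rightarrow> bool"
  where "retraction R Y Z \<beta> \<longleftrightarrow>
    \<beta> \<in> mod_hom R Y Z \<and> (\<exists>s\<in>mod_hom R Z Y. \<forall>z\<in>carrier Z. \<beta> (s z) = z)"

definition section_morphism ::
    "('r, 'm) ring_scheme \<Rightarrow> ('r, 'a) module \<Rightarrow> ('r, 'b) module \<Rightarrow> ('a \<Rightarrow> 'b) \<Rightarrow> bool"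
  where "section_morphism R X Y \<alpha> \<longleftrightarrow>
    \<alpha> \<in> mod_hom R X Y \<and> (\<exists>r\<in>mod_hom R Y X. \<forall>x\<in>carrier X. r (\<alpha> x) = x)"

definition right_almost_split ::
    "('r, 'm) ring_scheme \<Rightarrow> ('r, 'u) module \<Rightarrow> ('r, 'u) module \<Rightarrow> ('u \<Rightarrow> 'u) \<Rightarrow> bool"
  where "right_almost_split R Y Z \<beta> \<longleftrightarrow>
    \<beta> \<in> mod_hom R Y Z \<and> \<not> retraction R Y Z \<beta> \<and>
    (\<forall>(Y' :: ('r, 'u) module) f.
       module R Y' \<and> f \<in> mod_hom R Y' Z \<and> \<not> retraction R Y' Z f \<longrightarrow>
       (\<exists>g\<in>mod_hom R Y' Y. \<forall>y\<in>carrier Y'. f y = \<beta> (g y)))"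

definition left_almost_split ::
    "('r, 'm) ring_scheme \<Rightarrow> ('r, 'u) module \<Rightarrow> ('r, 'u) module \<Rightarrow> ('u \<Rightarrow> 'u) \<Rightarrow> bool"
  where "left_almost_split R X Y \<alpha> \<longleftrightarrow>
    \<alpha> \<in> mod_hom R X Y \<and> \<not> section_morphism R X Y \<alpha> \<and>
    (\<forall>(Y' :: ('r, 'u) module) f.
       module R Y' \<and> f \<in> mod_hom R X Y' \<and> \<not> section_morphism R X Y' f \<longrightarrow>
       (\<exists>g\<in>mod_hom R Y Y'. \<forall>x\<in>carrier X. f x = g (\<alpha> x)))"

definition short_exact ::
    "('r, 'm) ring_scheme \<Rightarrow> ('r, 'a) module \<Rightarrow> ('r, 'b) module \<Rightarrow> ('r, 'c) module \<Rightarrow>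
     ('a \<Rightarrow> 'b) \<Rightarrow> ('b \<Rightarrow> 'c) \<Rightarrow> bool"
  where "short_exact R X Y Z \<alpha> \<beta> \<longleftrightarrow>
    \<alpha> \<in> mod_hom R X Y \<and> \<beta> \<in> mod_hom R Y Z \<and>
    inj_on \<alpha> (carrier X) \<and> \<alpha> ` carrier X = a_kernel Y Z \<beta> \<and> \<beta> ` carrier Y = carrier Z"

definition almost_split_sequence ::
    "('r, 'm) ring_scheme \<Rightarrow> ('r, 'u) module \<Rightarrow> ('r, 'u) module \<Rightarrow> ('r, 'u) module \<Rightarrow>
     ('u \<Rightarrow> 'u) \<Rightarrow> ('u \<Rightarrow> 'u) \<Rightarrow> bool"
  where "almost_split_sequence R X Y Z \<alpha> \<beta> \<longleftrightarrow>
    module R X \<and> module R Y \<and> module R Z \<and>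
    short_exact R X Y Z \<alpha> \<beta> \<and> left_almost_split R X Y \<alpha> \<and> right_almost_split R Y Z \<beta>"

text \<open>
  The fields \<open>mult\<close> and \<open>one\<close> are part of the module record but play no role in the
  module structure.
\<close>

definition rat_module :: "(int, rat) module"
  where "rat_module =
    \<lparr>carrier = UNIV, mult = (*), one = 1, zero = 0, add = (+), smult = (\<lambda>k q. of_int k * q)\<rparr>"

lemma module_rat_module: "module \<Z> rat_module"
proof (rule moduleI)
  show "cring \<Z>" by (rule int_is_cring)
  show "abelian_group rat_module"
    by (rule abelian_groupI) (auto simp: rat_module_def intro: left_minus)
qed (auto simp: rat_module_def algebra_simps)

end

theory Submission
  imports Defs
begin

text \<open>
  Let \<open>0 \<rightarrow> X \<rightarrow> Y \<rightarrow> \<rat> \<rightarrow> 0\<close> be almost split and let \<open>k \<noteq> 0\<close> be an integer. If multiplication by \<open>k\<close>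
  on \<open>X\<close> were not a section, it would extend to \<open>Y\<close>, so the pushout of the sequence along it
  would split. This pushout is the pullback along multiplication by \<open>k\<close> on \<open>\<rat>\<close>, which is an
  automorphism, so the sequence itself would split. Hence \<open>k\<close> has a one-sided inverse on \<open>X\<close>,
  which is two-sided by linearity. Thus \<open>X\<close> and \<open>\<rat>\<close>, and therefore also \<open>Y\<close>, are uniquely
  divisible, so a preimage of \<open>1\<close> in \<open>Y\<close> extends to a homomorphism \<open>\<rat> \<rightarrow> Y\<close>, which splits
  the sequence.
\<close>

section \<open>Homomorphisms of modules and their kernels\<close>

lemma mod_homI:
  assumes "\<And>x. x \<in> carrier M \<Longrightarrow> f x \<in> carrier N"
    and "\<And>x y. x \<in> carrier M \<Longrightarrow> y \<in> carrier M \<Longrightarrow> f (x \<oplus>\<^bsub>M\<^esub> y) = f x \<oplus>\<^bsub>N\<^esub> f y"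
    and "\<And>r x. r \<in> carrier R \<Longrightarrow> x \<in> carrier M \<Longrightarrow> f (r \<odot>\<^bsub>M\<^esub> x) = r \<odot>\<^bsub>N\<^esub> f x"
  shows "f \<in> mod_hom R M N"
  using assms by (auto simp: mod_hom_def hom_def)

lemma mod_homD:
  assumes "f \<in> mod_hom R M N"
  shows mod_hom_closed: "x \<in> carrier M \<Longrightarrow> f x \<in> carrier N"
    and mod_hom_add:
      "x \<in> carrier M \<Longrightarrow> y \<in> carrier M \<Longrightarrow> f (x \<oplus>\<^bsub>M\<^esub> y) = f x \<oplus>\<^bsub>N\<^esub> f y"
    and mod_hom_smult:
      "r \<in> carrier R \<Longrightarrow> x \<in> carrier M \<Longrightarrow> f (r \<odot>\<^bsub>M\<^esub> x) = r \<odot>\<^bsub>N\<^esub> f x"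
  using assms by (auto simp: mod_hom_def hom_def)

lemma mod_hom_abelian_group_hom:
  assumes "module R M" "module R N" "f \<in> mod_hom R M N"
  shows "abelian_group_hom M N f"
  using assms by (intro abelian_group_homI group_hom.intro group_hom_axioms.intro)
    (auto simp: mod_hom_def module_def intro: abelian_group.a_group)

lemma mem_a_kernel_iff: "x \<in> a_kernel M N f \<longleftrightarrow> x \<in> carrier M \<and> f x = \<zero>\<^bsub>N\<^esub>"
  unfolding a_kernel_def' by blast

lemma (in abelian_group_hom) minus_mem_a_kernel:
  assumes "u \<in> carrier G" "v \<in> carrier G" "h u = h v"
  shows "u \<ominus>\<^bsub>G\<^esub> v \<in> a_kernel G H h"
proof -
  have "h (u \<ominus>\<^bsub>G\<^esub> v) = \<zero>\<^bsub>H\<^esub>"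
    using assms by (simp add: a_minus_def H.r_neg)
  with assms show ?thesis
    by (auto simp only: mem_a_kernel_iff intro: G.minus_closed)
qed

lemma (in abelian_group) eq_if_minus_zero:
  assumes "x \<in> carrier G" "y \<in> carrier G" "x \<ominus> y = \<zero>"
  shows "x = y"
  using minus_equality[of x "\<ominus> y"] assms by (simp add: a_minus_def)

lemma mod_hom_comp:
  assumes "f \<in> mod_hom R M N" "g \<in> mod_hom R N L"
  shows "(\<lambda>x. g (f x)) \<in> mod_hom R M L"
  by (rule mod_homI) (simp_all add: mod_homD[OF assms(1)] mod_homD[OF assms(2)])

lemma mod_hom_the_inv_into:
  assumes "module R M" "f \<in> mod_hom R M N" "bij_betw f (carrier M) (carrier N)"
  shows "the_inv_into (carrier M) f \<in> mod_hom R N M"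
proof -
  interpret M: module R M by fact
  note f = mod_homD[OF assms(2)]
  have inj: "inj_on f (carrier M)" and img: "f ` carrier M = carrier N"
    using assms(3) by (auto simp: bij_betw_def)
  let ?g = "the_inv_into (carrier M) f"
  have g: "?g y \<in> carrier M" "f (?g y) = y" if "y \<in> carrier N" for y
    using that inj img by (auto intro: the_inv_into_into f_the_inv_into_f)
  show ?thesis
  proof (rule mod_homI)
    fix x y assume "x \<in> carrier N" "y \<in> carrier N"
    then show "?g (x \<oplus>\<^bsub>N\<^esub> y) = ?g x \<oplus>\<^bsub>M\<^esub> ?g y"
      by (intro the_inv_into_f_eq[OF inj]) (simp_all add: f g)
  next
    fix r x assume "r \<in> carrier R" "x \<in> carrier N"
    then show "?g (r \<odot>\<^bsub>N\<^esub> x) = r \<odot>\<^bsub>M\<^esub> ?g x"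
      by (intro the_inv_into_f_eq[OF inj]) (simp_all add: f g)
  qed (rule g)
qed

text \<open>Compatibility with scalars rests on the commutativity of \<open>R\<close>, which is part
  of \<open>module\<close>: the factors \<open>r\<close> and \<open>q\<close> can be
  swapped.\<close>

lemma smult_mod_hom:
  assumes "module R M" "r \<in> carrier R"
  shows "(\<lambda>x. r \<odot>\<^bsub>M\<^esub> x) \<in> mod_hom R M M"
proof -
  interpret module R M by fact
  show ?thesis
  proof (rule mod_homI)
    fix q x assume q: "q \<in> carrier R" and x: "x \<in> carrier M"
    have "r \<odot>\<^bsub>M\<^esub> (q \<odot>\<^bsub>M\<^esub> x) = (r \<otimes>\<^bsub>R\<^esub> q) \<odot>\<^bsub>M\<^esub> x"
      using q x assms(2) by (simp add: smult_assoc1)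
    also have "\<dots> = (q \<otimes>\<^bsub>R\<^esub> r) \<odot>\<^bsub>M\<^esub> x"
      using q assms(2) by (simp add: m_comm)
    also have "\<dots> = q \<odot>\<^bsub>M\<^esub> (r \<odot>\<^bsub>M\<^esub> x)"
      using q x assms(2) by (simp add: smult_assoc1)
    finally show "r \<odot>\<^bsub>M\<^esub> (q \<odot>\<^bsub>M\<^esub> x) = q \<odot>\<^bsub>M\<^esub> (r \<odot>\<^bsub>M\<^esub> x)" .
  qed (simp_all add: assms(2) smult_r_distr)
qed

lemma mod_hom_minus:
  assumes "module R M" "module R N" "f \<in> mod_hom R M N" "g \<in> mod_hom R M N"
  shows "(\<lambda>x. f x \<ominus>\<^bsub>N\<^esub> g x) \<in> mod_hom R M N"
proof -
  interpret M: module R M by fact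
  interpret N: module R N by fact
  note f = mod_homD[OF assms(3)] and g = mod_homD[OF assms(4)]
  show ?thesis
    by (rule mod_homI)
      (simp_all add: f g a_minus_def N.minus_add N.a_ac N.smult_r_distr N.smult_r_minus)
qed

text \<open>Universal property of the quotient by the kernel: two preimages of a point under \<beta>
  differ by a kernel element, which \<open>f\<close> kills, so the value of \<open>f\<close> at an
  arbitrary preimage is well defined.\<close>

lemma mod_hom_factor:
  assumes "module R Y" "module R Z" "module R W"
    and \<beta>: "\<beta> \<in> mod_hom R Y Z" "\<beta> ` carrier Y = carrier Z"
    and f: "f \<in> mod_hom R Y W" "\<And>y. y \<in> a_kernel Y Z \<beta> \<Longrightarrow> f y = \<zero>\<^bsub>W\<^esub>"
  obtains t where "t \<in> mod_hom R Z W" "\<And>y. y \<in> carrier Y \<Longrightarrow> t (\<beta> y) = f y"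
proof -
  interpret Y: module R Y by fact
  interpret W: module R W by fact
  interpret b: abelian_group_hom Y Z \<beta>
    using assms by (intro mod_hom_abelian_group_hom)
  interpret f: abelian_group_hom Y W f
    using assms by (intro mod_hom_abelian_group_hom)
  define t where "t z = f (inv_into (carrier Y) \<beta> z)" for z
  have t: "t (\<beta> y) = f y" if y: "y \<in> carrier Y" for y
  proof -
    \<comment> \<open>The preimage of \<open>\<beta> y\<close> picked by choice, which may differ
      from \<open>y\<close>.\<close>
    define y' where "y' = inv_into (carrier Y) \<beta> (\<beta> y)"
    have y': "y' \<in> carrier Y" "\<beta> y' = \<beta> y"
      using y unfolding y'_def by (auto intro: inv_into_into f_inv_into_f)
    have "y' \<ominus>\<^bsub>Y\<^esub> y \<in> a_kernel Y Z \<beta>"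
      using y y' by (intro b.minus_mem_a_kernel)
    then have diff: "f y' \<ominus>\<^bsub>W\<^esub> f y = \<zero>\<^bsub>W\<^esub>"
      using f(2) y y' by (force simp: a_minus_def)
    then show ?thesis
      using W.eq_if_minus_zero[OF _ _ diff] y y' by (simp add: t_def flip: y'_def)
  qed
  have "t \<in> mod_hom R Z W"
  proof (rule mod_homI)
    fix x y assume "x \<in> carrier Z" "y \<in> carrier Z"
    then obtain x' y' where "x' \<in> carrier Y" "y' \<in> carrier Y" "x = \<beta> x'" "y = \<beta> y'"
      using \<beta>(2) by blast
    then show "t (x \<oplus>\<^bsub>Z\<^esub> y) = t x \<oplus>\<^bsub>W\<^esub> t y"
      by (simp add: t flip: b.hom_add)
  next
    fix r x assume r: "r \<in> carrier R" and "x \<in> carrier Z"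
    then obtain x' where "x' \<in> carrier Y" "x = \<beta> x'"
      using \<beta>(2) by blast
    with r show "t (r \<odot>\<^bsub>Z\<^esub> x) = r \<odot>\<^bsub>W\<^esub> t x"
      by (simp add: t mod_hom_smult[OF f(1)] flip: mod_hom_smult[OF \<beta>(1)])
  next
    fix x assume "x \<in> carrier Z"
    then obtain x' where "x' \<in> carrier Y" "x = \<beta> x'"
      using \<beta>(2) by blast
    then show "t x \<in> carrier W"
      by (simp add: t)
  qed
  then show thesis
    using t by (rule that)
qed

section \<open>Multiplication by a scalar on short exact sequences\<close>

text \<open>The pushout argument on elements: \<open>g\<close> extends multiplication by
  \<open>r\<close> along \<alpha>, so the difference of \<open>r y\<close> and
  \<open>\<alpha> (g y)\<close> vanishes on the image of \<alpha>. It therefore descends to a map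
  \<open>t\<close> from \<open>Z\<close> to \<open>Y\<close> whose composite with \<beta> is
  multiplication by \<open>r\<close>. Inverting \<open>r\<close> on \<open>Z\<close> turns
  \<open>t\<close> into a section of \<beta>.\<close>

lemma retraction_if_smult_extends:
  assumes "module R X" "module R Y" "module R Z" "short_exact R X Y Z \<alpha> \<beta>"
    and r: "r \<in> carrier R" "bij_betw (\<lambda>z. r \<odot>\<^bsub>Z\<^esub> z) (carrier Z) (carrier Z)"
    and g: "g \<in> mod_hom R Y X" "\<And>x. x \<in> carrier X \<Longrightarrow> g (\<alpha> x) = r \<odot>\<^bsub>X\<^esub> x"
  shows "retraction R Y Z \<beta>"
proof -
  interpret X: module R X by fact
  interpret Y: module R Y by fact
  interpret Z: module R Z by fact
  have \<alpha>: "\<alpha> \<in> mod_hom R X Y" and \<beta>: "\<beta> \<in> mod_hom R Y Z"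
    and ker: "\<alpha> ` carrier X = a_kernel Y Z \<beta>" and onto: "\<beta> ` carrier Y = carrier Z"
    using assms(4) by (auto simp: short_exact_def)
  interpret a: abelian_group_hom X Y \<alpha>
    using assms \<alpha> by (intro mod_hom_abelian_group_hom)
  interpret b: abelian_group_hom Y Z \<beta>
    using assms \<beta> by (intro mod_hom_abelian_group_hom)
  define f where "f y = r \<odot>\<^bsub>Y\<^esub> y \<ominus>\<^bsub>Y\<^esub> \<alpha> (g y)" for y
  have f: "f \<in> mod_hom R Y Y"
    unfolding f_def using assms \<alpha>
    by (intro mod_hom_minus smult_mod_hom mod_hom_comp[OF g(1)])
  have "f y = \<zero>\<^bsub>Y\<^esub>" if "y \<in> a_kernel Y Z \<beta>" for y
  proof -
    from that obtain x where x: "x \<in> carrier X" "y = \<alpha> x"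
      using ker by blast
    then show ?thesis
      using r(1) by (simp add: f_def g a_minus_def mod_hom_smult[OF \<alpha>] Y.r_neg)
  qed
  then obtain t where t: "t \<in> mod_hom R Z Y" "\<And>y. y \<in> carrier Y \<Longrightarrow> t (\<beta> y) = f y"
    using mod_hom_factor[OF assms(2,3,2) \<beta> onto f] by blast
  \<comment> \<open>The summand \<open>\<alpha> (g y)\<close> lies in the kernel of \<beta>, so only
    the multiple of \<open>\<beta> y\<close> survives.\<close>
  have bt: "\<beta> (t z) = r \<odot>\<^bsub>Z\<^esub> z" if "z \<in> carrier Z" for z
  proof -
    from that obtain y where y: "y \<in> carrier Y" "z = \<beta> y"
      using onto by blast
    have gy: "g y \<in> carrier X"
      using mod_hom_closed[OF g(1)] y by simp
    then have "\<alpha> (g y) \<in> a_kernel Y Z \<beta>"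
      using ker by blast
    then have "\<beta> (\<alpha> (g y)) = \<zero>\<^bsub>Z\<^esub>"
      by (blast dest: mem_a_kernel_iff[THEN iffD1])
    then show ?thesis
      using y gy r(1) by (simp add: t(2) f_def a_minus_def mod_hom_smult[OF \<beta>])
  qed
  \<comment> \<open>Division by \<open>r\<close> on \<open>Z\<close>, the correction that makes
    \<open>t\<close> a section.\<close>
  let ?d = "the_inv_into (carrier Z) (\<lambda>z. r \<odot>\<^bsub>Z\<^esub> z)"
  have d: "?d \<in> mod_hom R Z Z"
    using assms(3) r by (intro mod_hom_the_inv_into smult_mod_hom)
  have "\<beta> (t (?d z)) = z" if "z \<in> carrier Z" for z
    using that mod_hom_closed[OF d that] r(2)
    by (simp add: bt f_the_inv_into_f_bij_betw)
  then show ?thesis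
    unfolding retraction_def using \<beta>
    by (intro conjI bexI[OF _ mod_hom_comp[OF d t(1)]] ballI) simp_all
qed

text \<open>The left inverse \<open>q\<close> is linear, so it commutes with multiplication by
  \<open>r\<close> and is a right inverse too.\<close>

lemma bij_smult_if_section:
  assumes "module R X" "r \<in> carrier R" "section_morphism R X X (\<lambda>x. r \<odot>\<^bsub>X\<^esub> x)"
  shows "bij_betw (\<lambda>x. r \<odot>\<^bsub>X\<^esub> x) (carrier X) (carrier X)"
proof -
  interpret module R X by fact
  obtain q where q: "q \<in> mod_hom R X X" "\<And>x. x \<in> carrier X \<Longrightarrow> q (r \<odot>\<^bsub>X\<^esub> x) = x"
    using assms(3) by (auto simp: section_morphism_def)
  show ?thesis
  proof (rule bij_betw_byWitness[where f' = q])
    show "\<forall>x\<in>carrier X. r \<odot>\<^bsub>X\<^esub> q x = x"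
      using q(2) mod_hom_smult[OF q(1)] assms(2) by fastforce
  qed (use assms(2) q mod_hom_closed[OF q(1)] in auto)
qed

text \<open>The five lemma for multiplication by \<open>r\<close> as an endomorphism of the
  sequence, done as a diagram chase.\<close>

lemma bij_smult_middle:
  assumes "module R X" "module R Y" "module R Z" "short_exact R X Y Z \<alpha> \<beta>"
    and r: "r \<in> carrier R"
    and X: "bij_betw (\<lambda>x. r \<odot>\<^bsub>X\<^esub> x) (carrier X) (carrier X)"
    and Z: "bij_betw (\<lambda>z. r \<odot>\<^bsub>Z\<^esub> z) (carrier Z) (carrier Z)"
  shows "bij_betw (\<lambda>y. r \<odot>\<^bsub>Y\<^esub> y) (carrier Y) (carrier Y)"
proof -
  interpret X: module R X by fact
  interpret Y: module R Y by fact
  interpret Z: module R Z by fact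
  have \<alpha>: "\<alpha> \<in> mod_hom R X Y" and \<beta>: "\<beta> \<in> mod_hom R Y Z"
    and inj: "inj_on \<alpha> (carrier X)"
    and ker: "\<alpha> ` carrier X = a_kernel Y Z \<beta>" and onto: "\<beta> ` carrier Y = carrier Z"
    using assms(4) by (auto simp: short_exact_def)
  interpret a: abelian_group_hom X Y \<alpha>
    using assms \<alpha> by (intro mod_hom_abelian_group_hom)
  interpret b: abelian_group_hom Y Z \<beta>
    using assms \<beta> by (intro mod_hom_abelian_group_hom)
  \<comment> \<open>Injectivity on \<open>Z\<close> puts the difference of \<open>u\<close> and
    \<open>v\<close> into the kernel of \<beta>, so it equals \<open>\<alpha> x\<close>. Then
    \<open>r\<close> annihilates \<open>x\<close>, and injectivity on \<open>X\<close> gives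
    \<open>x = 0\<close>.\<close>
  have "u = v"
    if uv: "u \<in> carrier Y" "v \<in> carrier Y" "r \<odot>\<^bsub>Y\<^esub> u = r \<odot>\<^bsub>Y\<^esub> v" for u v
  proof -
    have "r \<odot>\<^bsub>Z\<^esub> \<beta> u = r \<odot>\<^bsub>Z\<^esub> \<beta> v"
      using uv r by (simp flip: mod_hom_smult[OF \<beta>])
    then have "\<beta> u = \<beta> v"
      using inj_onD[OF bij_betw_imp_inj_on[OF Z]] uv by simp
    then have "u \<ominus>\<^bsub>Y\<^esub> v \<in> a_kernel Y Z \<beta>"
      using uv by (intro b.minus_mem_a_kernel)
    then obtain x where x: "x \<in> carrier X" "u \<ominus>\<^bsub>Y\<^esub> v = \<alpha> x"
      unfolding ker[symmetric] by (rule imageE)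
    have "\<alpha> (r \<odot>\<^bsub>X\<^esub> x) = r \<odot>\<^bsub>Y\<^esub> (u \<ominus>\<^bsub>Y\<^esub> v)"
      using r x by (simp add: mod_hom_smult[OF \<alpha>])
    also have "\<dots> = \<alpha> (r \<odot>\<^bsub>X\<^esub> \<zero>\<^bsub>X\<^esub>)"
      using uv r by (simp add: a_minus_def Y.smult_r_distr Y.smult_r_minus Y.r_neg)
    finally have "r \<odot>\<^bsub>X\<^esub> x = r \<odot>\<^bsub>X\<^esub> \<zero>\<^bsub>X\<^esub>"
      using inj_onD[OF inj] r x by blast
    then have "x = \<zero>\<^bsub>X\<^esub>"
      using inj_onD[OF bij_betw_imp_inj_on[OF X]] x by blast
    with x uv show ?thesis
      by (auto intro: Y.eq_if_minus_zero[of u v])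
  qed
  \<comment> \<open>Divide \<open>\<beta> y\<close> by \<open>r\<close> in \<open>Z\<close> and lift
    the quotient to \<open>u\<close>. The error, \<open>y\<close> minus \<open>r u\<close>, comes
    from \<open>X\<close>, where it can be divided by \<open>r\<close> as well.\<close>
  moreover have "\<exists>v\<in>carrier Y. y = r \<odot>\<^bsub>Y\<^esub> v" if y: "y \<in> carrier Y" for y
  proof -
    obtain z where z: "z \<in> carrier Z" "\<beta> y = r \<odot>\<^bsub>Z\<^esub> z"
      using bij_betw_imp_surj_on[OF Z] y by (metis b.hom_closed imageE)
    obtain u where "u \<in> carrier Y" "z = \<beta> u"
      using z(1) unfolding onto[symmetric] by (rule imageE)
    with z have u: "u \<in> carrier Y" "\<beta> y = r \<odot>\<^bsub>Z\<^esub> \<beta> u"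
      by simp_all
    then have "y \<ominus>\<^bsub>Y\<^esub> r \<odot>\<^bsub>Y\<^esub> u \<in> a_kernel Y Z \<beta>"
      using y r by (intro b.minus_mem_a_kernel) (simp_all add: mod_hom_smult[OF \<beta>])
    then obtain x where "x \<in> carrier X" "y \<ominus>\<^bsub>Y\<^esub> r \<odot>\<^bsub>Y\<^esub> u = \<alpha> x"
      unfolding ker[symmetric] by (rule imageE)
    then obtain x' where x': "x' \<in> carrier X" "y \<ominus>\<^bsub>Y\<^esub> r \<odot>\<^bsub>Y\<^esub> u = \<alpha> (r \<odot>\<^bsub>X\<^esub> x')"
      using bij_betw_imp_surj_on[OF X] by (metis imageE)
    have "y = (y \<ominus>\<^bsub>Y\<^esub> r \<odot>\<^bsub>Y\<^esub> u) \<oplus>\<^bsub>Y\<^esub> r \<odot>\<^bsub>Y\<^esub> u"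
      using y u(1) r by (simp add: a_minus_def Y.a_assoc Y.l_neg)
    also have "\<dots> = r \<odot>\<^bsub>Y\<^esub> (\<alpha> x' \<oplus>\<^bsub>Y\<^esub> u)"
      using x' u(1) r by (simp add: mod_hom_smult[OF \<alpha>] Y.smult_r_distr)
    finally show ?thesis
      by (rule bexI) (simp add: x'(1) u(1))
  qed
  ultimately show ?thesis
    using r by (intro bij_betwI' Y.smult_closed) metis+
qed

section \<open>Homomorphisms from \<rat> and divisibility\<close>

text \<open>Unique divisibility leaves exactly one candidate for the image of \<open>c / d\<close>,
  namely the solution \<open>v\<close> of \<open>d v = c y\<close>.\<close>

lemma rat_module_hom_exists:
  fixes Y :: "(int, 'a) module"
  assumes "module \<Z> Y"
    and bij: "\<And>k. k \<noteq> 0 \<Longrightarrow> bij_betw (\<lambda>y. k \<odot>\<^bsub>Y\<^esub> y) (carrier Y) (carrier Y)"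
    and y: "y \<in> carrier Y"
  obtains s where "s \<in> mod_hom \<Z> rat_module Y" "s 1 = y"
proof -
  interpret Y: module \<Z> Y by fact
  have closed [simp]: "k \<odot>\<^bsub>Y\<^esub> u \<in> carrier Y" if "u \<in> carrier Y" for k u
    using that by simp
  have assoc: "k \<odot>\<^bsub>Y\<^esub> (l \<odot>\<^bsub>Y\<^esub> u) = (k * l) \<odot>\<^bsub>Y\<^esub> u" if "u \<in> carrier Y" for k l u
    using that Y.smult_assoc1[of k l u] by simp
  have distrib: "(k + l) \<odot>\<^bsub>Y\<^esub> u = k \<odot>\<^bsub>Y\<^esub> u \<oplus>\<^bsub>Y\<^esub> l \<odot>\<^bsub>Y\<^esub> u" if "u \<in> carrier Y" for k l u
    using that Y.smult_l_distr[of k l u] by simp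
  have cancel: "u = v"
    if "k \<odot>\<^bsub>Y\<^esub> u = k \<odot>\<^bsub>Y\<^esub> v" "k \<noteq> 0" "u \<in> carrier Y" "v \<in> carrier Y" for k u v
    using inj_onD[OF bij_betw_imp_inj_on[OF bij[OF that(2)]] that(1)] that by simp
  \<comment> \<open>The reduced fraction given by \<open>quotient_of\<close> has a positive
    denominator, so \<open>bij\<close> applies to it.\<close>
  have "\<exists>v. v \<in> carrier Y \<and>
      snd (quotient_of q) \<odot>\<^bsub>Y\<^esub> v = fst (quotient_of q) \<odot>\<^bsub>Y\<^esub> y" for q
    using bij_betw_imp_surj_on[OF bij[of "snd (quotient_of q)"]] y closed[OF y]
      quotient_of_denom_pos'[of q]
    by (metis imageE less_irrefl)
  then obtain s where s: "s q \<in> carrier Y"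
      "snd (quotient_of q) \<odot>\<^bsub>Y\<^esub> s q = fst (quotient_of q) \<odot>\<^bsub>Y\<^esub> y" for q
    by metis
  \<comment> \<open>The value \<open>s q\<close> can be read off from any fraction
    \<open>a / b\<close> that represents \<open>q\<close>, reduced or not. This allows the
    homomorphism laws to be checked with arbitrary common denominators.\<close>
  have s_eq: "s q = w"
    if w: "w \<in> carrier Y" "b \<odot>\<^bsub>Y\<^esub> w = a \<odot>\<^bsub>Y\<^esub> y" and b: "b \<noteq> 0" "of_int b * q = of_int a"
    for q w a b
  proof -
    obtain c d where cd: "quotient_of q = (c, d)" by force
    then have d: "d > 0" "q = of_int c / of_int d"
      by (auto intro: quotient_of_denom_pos quotient_of_div)
    have "of_int (b * c) = (of_int (a * d) :: rat)"
      using d by (simp flip: b(2))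
    then have bc: "b * c = d * a"
      by (simp only: of_int_eq_iff mult.commute[of d])
    \<comment> \<open>Both candidates are compared after multiplication by the nonzero integer
      \<open>d * b\<close>, where the cross-multiplied identity \<open>bc\<close> applies, and the
      factor is then cancelled.\<close>
    have "(d * b) \<odot>\<^bsub>Y\<^esub> s q = b \<odot>\<^bsub>Y\<^esub> (d \<odot>\<^bsub>Y\<^esub> s q)"
      using s(1) by (simp add: assoc mult.commute)
    also have "\<dots> = b \<odot>\<^bsub>Y\<^esub> (c \<odot>\<^bsub>Y\<^esub> y)"
      using s(2)[of q] cd by simp
    also have "\<dots> = d \<odot>\<^bsub>Y\<^esub> (a \<odot>\<^bsub>Y\<^esub> y)"
      using y by (simp add: assoc bc)
    also have "\<dots> = (d * b) \<odot>\<^bsub>Y\<^esub> w"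
      using w by (simp flip: w(2) add: assoc)
    finally show ?thesis
      using cancel b d s(1) w(1) by (metis mult_eq_0_iff less_irrefl)
  qed
  have frac: "\<exists>a b. b \<noteq> 0 \<and> of_int b * q = of_int a \<and> b \<odot>\<^bsub>Y\<^esub> s q = a \<odot>\<^bsub>Y\<^esub> y" for q
  proof -
    obtain c d where cd: "quotient_of q = (c, d)" by force
    then have "d > 0" "q = of_int c / of_int d"
      by (auto intro: quotient_of_denom_pos quotient_of_div)
    with cd s(2)[of q] show ?thesis
      by (intro exI[of _ c] exI[of _ d]) auto
  qed
  have "s \<in> mod_hom \<Z> rat_module Y"
  proof (rule mod_homI)
    fix p q
    obtain a b where ab: "b \<noteq> 0" "of_int b * p = of_int a" "b \<odot>\<^bsub>Y\<^esub> s p = a \<odot>\<^bsub>Y\<^esub> y"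
      using frac by blast
    obtain c d where cd: "d \<noteq> 0" "of_int d * q = of_int c" "d \<odot>\<^bsub>Y\<^esub> s q = c \<odot>\<^bsub>Y\<^esub> y"
      using frac by blast
    \<comment> \<open>Addition over a common denominator: \<open>p + q\<close> is represented by
      \<open>(d * a + b * c) / (b * d)\<close>.\<close>
    have "(b * d) \<odot>\<^bsub>Y\<^esub> (s p \<oplus>\<^bsub>Y\<^esub> s q) = d \<odot>\<^bsub>Y\<^esub> (b \<odot>\<^bsub>Y\<^esub> s p) \<oplus>\<^bsub>Y\<^esub> b \<odot>\<^bsub>Y\<^esub> (d \<odot>\<^bsub>Y\<^esub> s q)"
      using s(1) Y.smult_r_distr[of "b * d" "s p" "s q"] by (simp add: assoc mult.commute)
    also have "\<dots> = (d * a + b * c) \<odot>\<^bsub>Y\<^esub> y"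
      using y by (simp add: ab cd assoc distrib)
    finally have "s (p + q) = s p \<oplus>\<^bsub>Y\<^esub> s q"
      using ab(1) cd(1) s(1)
      by (intro s_eq[of _ "b * d" "d * a + b * c"]) (simp_all add: algebra_simps flip: ab(2) cd(2))
    then show "s (p \<oplus>\<^bsub>rat_module\<^esub> q) = s p \<oplus>\<^bsub>Y\<^esub> s q"
      by (simp add: rat_module_def)
  next
    fix k q
    obtain a b where ab: "b \<noteq> 0" "of_int b * q = of_int a" "b \<odot>\<^bsub>Y\<^esub> s q = a \<odot>\<^bsub>Y\<^esub> y"
      using frac by blast
    have "b \<odot>\<^bsub>Y\<^esub> (k \<odot>\<^bsub>Y\<^esub> s q) = k \<odot>\<^bsub>Y\<^esub> (b \<odot>\<^bsub>Y\<^esub> s q)"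
      using s(1) by (simp add: assoc mult.commute)
    also have "\<dots> = (k * a) \<odot>\<^bsub>Y\<^esub> y"
      using y by (simp add: ab assoc)
    finally have "s (of_int k * q) = k \<odot>\<^bsub>Y\<^esub> s q"
      using ab(1) s(1)
      by (intro s_eq[of _ b "k * a"]) (simp_all add: algebra_simps flip: ab(2))
    then show "s (k \<odot>\<^bsub>rat_module\<^esub> q) = k \<odot>\<^bsub>Y\<^esub> s q"
      by (simp add: rat_module_def)
  qed (rule s)
  moreover have "s 1 = y"
    using y by (intro s_eq[of _ 1 1]) auto
  ultimately show thesis
    by (rule that)
qed

text \<open>For \<open>q = c / d\<close>, linearity gives
  \<open>d * f q = f c = c * f 1 = c\<close>, so the value at \<open>1\<close> determines
  \<open>f\<close>.\<close>

lemma rat_module_endo_eq_id: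
  assumes f: "f \<in> mod_hom \<Z> rat_module rat_module" and "f 1 = 1"
  shows "f q = q"
proof -
  have lin: "f (of_int k * p) = of_int k * f p" for k p
    using mod_hom_smult[OF f, of k p] by (simp add: rat_module_def)
  obtain c d where "quotient_of q = (c, d)" by force
  then have d: "d > 0" "q = of_int c / of_int d"
    by (auto intro: quotient_of_denom_pos quotient_of_div)
  have "of_int d * f q = of_int d * q"
    using lin[of d q] lin[of c 1] d assms(2) by simp
  with d(1) show ?thesis
    by simp
qed

text \<open>Division by \<open>k\<close> exists in \<rat> and is carried back to \<open>Z\<close>
  along the isomorphism.\<close>

lemma bij_smult_rat_module_iso:
  assumes "module \<Z> Z" "mod_iso \<Z> Z rat_module" "k \<noteq> 0"
  shows "bij_betw (\<lambda>z. k \<odot>\<^bsub>Z\<^esub> z) (carrier Z) (carrier Z)"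
proof -
  interpret Z: module \<Z> Z by fact
  obtain h where h: "h \<in> mod_hom \<Z> Z rat_module" "bij_betw h (carrier Z) UNIV"
    using assms(2) by (auto simp: mod_iso_def rat_module_def)
  have hk: "h (k \<odot>\<^bsub>Z\<^esub> z) = of_int k * h z" if "z \<in> carrier Z" for z
    using mod_hom_smult[OF h(1), of k z] that by (simp add: rat_module_def)
  define g where "g = the_inv_into (carrier Z) h"
  have g: "g q \<in> carrier Z" "h (g q) = q" for q
    using h(2) the_inv_into_into[OF bij_betw_imp_inj_on[OF h(2)], of q]
    by (auto simp: g_def f_the_inv_into_f_bij_betw bij_betw_imp_surj_on)
  have gh: "g (h z) = z" if "z \<in> carrier Z" for z
    using that h(2) by (simp add: g_def the_inv_into_f_f bij_betw_imp_inj_on)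
  have inj: "u = v" if "u \<in> carrier Z" "v \<in> carrier Z" "h u = h v" for u v
    using that gh by metis
  show ?thesis
    by (rule bij_betw_byWitness[where f' = "\<lambda>z. g (h z / of_int k)"])
      (use assms(3) in \<open>auto simp: hk g gh intro: inj\<close>)
qed

section \<open>Splitting of a sequence that ends in \<rat>\<close>

theorem proposition3p1:
  shows "\<not> (\<exists>(X :: (int, 'u) module) (Y :: (int, 'u) module) (Z :: (int, 'u) module) \<alpha> \<beta>.
           mod_iso \<Z> Z rat_module \<and> almost_split_sequence \<Z> X Y Z \<alpha> \<beta>)"
proof (rule notI, elim exE conjE)
  fix X Y Z :: "(int, 'u) module" and \<alpha> \<beta>
  assume iso: "mod_iso \<Z> Z rat_module" and ass: "almost_split_sequence \<Z> X Y Z \<alpha> \<beta>"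
  then have mods: "module \<Z> X" "module \<Z> Y" "module \<Z> Z"
    and exact: "short_exact \<Z> X Y Z \<alpha> \<beta>"
    and left: "left_almost_split \<Z> X Y \<alpha>"
    and nonsplit: "\<not> retraction \<Z> Y Z \<beta>"
    by (auto simp: almost_split_sequence_def right_almost_split_def)
  have \<beta>: "\<beta> \<in> mod_hom \<Z> Y Z" and onto: "\<beta> ` carrier Y = carrier Z"
    using exact by (auto simp: short_exact_def)
  have bijY: "bij_betw (\<lambda>y. k \<odot>\<^bsub>Y\<^esub> y) (carrier Y) (carrier Y)" if k: "k \<noteq> 0" for k
  proof -
    note bijZ = bij_smult_rat_module_iso[OF mods(3) iso k]
    have kZ: "k \<in> carrier \<Z>" by simp
    have "section_morphism \<Z> X X (\<lambda>x. k \<odot>\<^bsub>X\<^esub> x)"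
    \<comment> \<open>The left almost split property is tested on the object \<open>X\<close>
      itself, with multiplication by \<open>k\<close> as the morphism. The resulting extension to
      \<open>Y\<close> would split \<beta>.\<close>
    proof (rule ccontr)
      assume "\<not> section_morphism \<Z> X X (\<lambda>x. k \<odot>\<^bsub>X\<^esub> x)"
      then obtain g where g: "g \<in> mod_hom \<Z> Y X" "\<forall>x\<in>carrier X. k \<odot>\<^bsub>X\<^esub> x = g (\<alpha> x)"
        using left mods(1) smult_mod_hom[OF mods(1) kZ]
        unfolding left_almost_split_def by blast
      then show False
        using retraction_if_smult_extends[OF mods exact kZ bijZ g(1)] g(2) nonsplit
        by simp
    qed
    then show ?thesis
      by (intro bij_smult_middle[OF mods exact kZ _ bijZ] bij_smult_if_section[OF mods(1) kZ])
  qed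
  \<comment> \<open>\<open>Z\<close> is a copy of \<rat> with carrier in \<open>'u\<close>, so
    \<rat> is reached through \<open>h\<close>.\<close>
  obtain h where h: "h \<in> mod_hom \<Z> Z rat_module" "bij_betw h (carrier Z) UNIV"
    using iso by (auto simp: mod_iso_def rat_module_def)
  obtain y where y: "y \<in> carrier Y" "h (\<beta> y) = 1"
    using bij_betw_imp_surj_on[OF h(2)] onto by (metis UNIV_I imageE)
  obtain s where s: "s \<in> mod_hom \<Z> rat_module Y" "s 1 = y"
    using rat_module_hom_exists[OF mods(2) bijY y(1)] by blast
  \<comment> \<open>By the choice of \<open>y\<close>, this endomorphism of \<rat> fixes
    \<open>1\<close>, hence it is the identity.\<close>
  have "(\<lambda>q. h (\<beta> (s q))) \<in> mod_hom \<Z> rat_module rat_module"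
    by (rule mod_hom_comp[OF mod_hom_comp[OF s(1) \<beta>] h(1)])
  then have hbs: "h (\<beta> (s q)) = q" for q
    by (rule rat_module_endo_eq_id) (simp add: s(2) y(2))
  \<comment> \<open>The section of \<beta> is \<open>s\<close> after \<open>h\<close>: the identity
    \<open>hbs\<close> at \<open>h z\<close> can be cancelled by the injectivity of
    \<open>h\<close>.\<close>
  note sh = mod_hom_comp[OF h(1) s(1)]
  have "\<beta> (s (h z)) = z" if "z \<in> carrier Z" for z
    by (rule inj_onD[OF bij_betw_imp_inj_on[OF h(2)] hbs mod_hom_closed[OF \<beta>] that])
      (rule mod_hom_closed[OF sh that])
  then have "retraction \<Z> Y Z \<beta>"
    unfolding retraction_def using \<beta> by (intro conjI bexI[OF _ sh] ballI) simp_all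
  with nonsplit show False ..
qed

end
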